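(* Let $A\in\mathbb{C}^{n\times n}$, let $\sigma\in\mathbb{C}$ be a fixed target that is not an eigenvalue of $A$, and run the SIRA method and the JD method with fixed target $\sigma$ (both as described in the context) from the same initial subspace $\mathcal{V}\subseteq\mathbb{C}^n$, with the inner linear systems $$(A-\sigma I)u=r_S\qquad\text{(SIRA)}$$ and $$(I-yy^H)(A-\sigma I)(I-yy^H)u=-r_J,\quad u\perp y\qquad\text{(JD)}$$ solved exactly at each step. If $\sigma\neq\nu$ (at each step), then the two methods are mathematically equivalent: at every step they generate the same subspace $\mathcal{V}$ and the same approximate eigenpair $(\nu,y)$ (with $y$ determined up to a scalar of modulus one).
   Context: $I$ is the identity matrix, the superscript $H$ denotes conjugate transpose, $\|\cdot\|$ is the 2-norm. One step of each method, given a subspace $\mathcal{V}$ with a matrix $V$ whose columns form an orthonormal basis of $\mathcal{V}$, is as follows. SIRA method with target $\sigma$: 1. Compute $H=V^HAV$. 2. Choose an eigenpair $(\nu,z)$ of $H$, $\|z\|=1$, with $\nu$ the approximation to the desired eigenvalue $\lambda$ of $A$ (the eigenvalue of $A$ nearest to $\sigma$). 3. Set $y=Vz$ and $r_S=Ay-\nu y$. 4. Solve $(A-\sigma I)u=r_S$ for $u$. 5. Orthonormalize $u$ against $V$ to get $v$. 6. Expand the subspace to that spanned by the columns of $[V\ \ v]$, i.e. to $\mathcal{V}+\mathrm{span}\{u\}$, and repeat (until the residual norm is below a tolerance). JD method with fixed target $\sigma$: identical, except that with $r_J=Ay-\nu y$ step 4 is replaced by: solve the correction equation $(I-yy^H)(A-\sigma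 I)(I-yy^H)u=-r_J$ for $u\perp y$. Both methods use the same rule for selecting the eigenpair of $H$ in step 2, depending only on the subspace $\mathcal{V}$ (for example, the $\nu$ closest to $\sigma$). "Solved exactly" means that $u$ is an exact solution of the respective inner system (in particular, an exact solution of the correction equation exists). *)

theory Defs
  imports "Jordan_Normal_Form.Schur_Decomposition" "Jordan_Normal_Form.VS_Connect"
begin

abbreviation colspan :: "complex mat \<Rightarrow> complex vec set" where
  "colspan V \<equiv> vec_space.col_space (dim_row V) V"

definition norm2 :: "complex vec \<Rightarrow> real" where
  "norm2 v = sqrt (Re (v \<bullet>c v))"

definition orthonormal_cols :: "complex mat \<Rightarrow> bool" where
  "orthonormal_cols V \<longleftrightarrow> mat_adjoint V * V = 1\<^sub>m (dim_col V)"

(* I - y y^H *)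
definition compl_proj :: "complex vec \<Rightarrow> complex mat" where
  "compl_proj y = 1\<^sub>m (dim_vec y)
     - mat (dim_vec y) (dim_vec y) (\<lambda>(i, j). y $ i * cnj (y $ j))"

definition shifted :: "complex mat \<Rightarrow> complex \<Rightarrow> complex mat" where
  "shifted A \<sigma> = A - \<sigma> \<cdot>\<^sub>m 1\<^sub>m (dim_row A)"

definition residual :: "complex mat \<Rightarrow> complex \<Rightarrow> complex vec \<Rightarrow> complex vec" where
  "residual A \<nu> y = A *\<^sub>v y - \<nu> \<cdot>\<^sub>v y"

(* A selection rule maps a subspace to the chosen value and a representative of the chosen
   approximate eigenvector; a method may use any unimodular multiple of the representative,
   since z is only fixed up to such a factor.  That the chosen pair comes from an eigenpair
   of V^H A V is demanded only at the subspaces that a run visits, in extracts. *)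
type_synonym selection = "complex vec set \<Rightarrow> complex \<times> complex vec"

definition extracts ::
  "complex mat \<Rightarrow> selection \<Rightarrow> complex mat \<Rightarrow> complex \<Rightarrow> complex vec \<Rightarrow> bool" where
  "extracts A sel V \<nu> y \<longleftrightarrow>
     (\<exists>z. eigenvector (mat_adjoint V * A * V) z \<nu> \<and> norm2 z = 1 \<and> y = V *\<^sub>v z) \<and>
     \<nu> = fst (sel (colspan V)) \<and>
     (\<exists>c. cmod c = 1 \<and> y = c \<cdot>\<^sub>v snd (sel (colspan V)))"

definition sira_solution ::
  "complex mat \<Rightarrow> complex \<Rightarrow> complex \<Rightarrow> complex vec \<Rightarrow> complex vec \<Rightarrow> bool" where
  "sira_solution A \<sigma> \<nu> y u \<longleftrightarrow>
     u \<in> carrier_vec (dim_row A) \<and> shifted A \<sigma> *\<^sub>v u = residual A \<nu> y"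

definition jd_solution ::
  "complex mat \<Rightarrow> complex \<Rightarrow> complex \<Rightarrow> complex vec \<Rightarrow> complex vec \<Rightarrow> bool" where
  "jd_solution A \<sigma> \<nu> y u \<longleftrightarrow>
     u \<in> carrier_vec (dim_row A) \<and> u \<bullet>c y = 0 \<and>
     (compl_proj y * shifted A \<sigma> * compl_proj y) *\<^sub>v u = - residual A \<nu> y"

(* The new column v is a normalized component of u orthogonal to the columns of V, so it is
   determined by u and V up to a unimodular factor.  If u already lies in the column space,
   that component vanishes and the subspace plus span {u} is the old subspace, so V is kept. *)
definition expands :: "complex mat \<Rightarrow> complex vec \<Rightarrow> complex mat \<Rightarrow> bool" where
  "expands V u V' \<longleftrightarrow>
     (if u \<in> colspan V then V' = V
      else \<exists>h v \<eta>. h \<in> carrier_vec (dim_col V) \<and> v \<in> carrier_vec (dim_row V) \<and>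
             mat_adjoint V *\<^sub>v v = 0\<^sub>v (dim_col V) \<and> norm2 v = 1 \<and>
             u = V *\<^sub>v h + \<eta> \<cdot>\<^sub>v v \<and>
             V' = mat_of_cols (dim_row V) (cols V @ [v]))"

(* A run with N expansions visits V 0, ..., V N.  A stopping test on the residual norm only
   limits how large N becomes; finite runs of every length N are considered instead. *)
definition is_run ::
  "(complex \<Rightarrow> complex vec \<Rightarrow> complex vec \<Rightarrow> bool) \<Rightarrow> complex mat \<Rightarrow> selection \<Rightarrow> complex vec set \<Rightarrow>
   nat \<Rightarrow> (nat \<Rightarrow> complex mat) \<Rightarrow> (nat \<Rightarrow> complex) \<Rightarrow> (nat \<Rightarrow> complex vec) \<Rightarrow> bool" where
  "is_run solution A sel W N V \<nu> y \<longleftrightarrow>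
     dim_row (V 0) = dim_row A \<and> orthonormal_cols (V 0) \<and> colspan (V 0) = W \<and>
     (\<forall>j\<le>N. extracts A sel (V j) (\<nu> j) (y j)) \<and>
     (\<forall>j<N. \<exists>u. solution (\<nu> j) (y j) u \<and> expands (V j) u (V (Suc j)))"

definition sira_run where
  "sira_run A \<sigma> = is_run (sira_solution A \<sigma>) A"

definition jd_run where
  "jd_run A \<sigma> = is_run (jd_solution A \<sigma>) A"

end

theory Submission
  imports Defs
begin

text \<open>
  Write \<open>B = A - \<sigma>I\<close>, which is injective because \<open>\<sigma>\<close> is not an eigenvalue of \<open>A\<close>. The residual of
  \<open>(\<nu>, y)\<close> is \<open>B y + (\<sigma> - \<nu>) y\<close>, so each inner equation says that \<open>B\<close> maps a known translate of
  its solution \<open>u\<close> by a multiple of \<open>y\<close> into the line spanned by \<open>y\<close>: for SIRA,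
  \<open>B (u - y) = (\<sigma> - \<nu>) y\<close>; for JD, since the left projector only subtracts a multiple of \<open>y\<close> and
  the right one fixes \<open>u\<close>, \<open>B (u + y) = \<beta> y\<close> for some scalar \<open>\<beta>\<close>. Here \<open>\<sigma> - \<nu> \<noteq> 0\<close> by hypothesis
  and \<open>\<beta> \<noteq> 0\<close> because \<open>u \<bottom> y \<noteq> 0\<close> forces \<open>u + y \<noteq> 0\<close>. Hence both translates span the same line
  \<open>B\<^sup>-\<^sup>1 (span {y})\<close> (\<open>sira_jd_solutions_proportional\<close>). As \<open>y\<close> already belongs to the
  current subspace, both methods enlarge it by that line. The pair \<open>(\<nu>, y)\<close> is a function of the
  subspace up to a unimodular factor of \<open>y\<close>, so the theorem follows by induction on the steps.

  What remains is to see that \<open>y = V z\<close> is nonzero at every step. This holds as long as the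
  columns of \<open>V\<close> are linearly independent, which every expansion preserves
  (\<open>run_basis\<close>).
\<close>

section \<open>Expansion of the subspace\<close>

lemma colspan_iff:
  "w \<in> colspan V \<longleftrightarrow> (\<exists>x \<in> carrier_vec (dim_col V). w = V *\<^sub>v x)"
  by (auto simp: vec_space.col_space_eq[of V "dim_row V" "dim_col V"] intro: carrier_vecI)

lemma colspan_carrier: "w \<in> colspan V \<Longrightarrow> w \<in> carrier_vec (dim_row V)"
  by (auto simp: colspan_iff intro: carrier_vecI)

lemma colspan_lincomb:
  assumes "w \<in> colspan V" and "w' \<in> colspan V"
  shows "a \<cdot>\<^sub>v w + b \<cdot>\<^sub>v w' \<in> colspan V"
proof -
  obtain x x' where x: "x \<in> carrier_vec (dim_col V)" "w = V *\<^sub>v x"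
    and x': "x' \<in> carrier_vec (dim_col V)" "w' = V *\<^sub>v x'"
    using assms unfolding colspan_iff by blast
  have V: "V \<in> carrier_mat (dim_row V) (dim_col V)" by simp
  have "a \<cdot>\<^sub>v w + b \<cdot>\<^sub>v w' = V *\<^sub>v (a \<cdot>\<^sub>v x + b \<cdot>\<^sub>v x')"
    using x x' by (simp add: mult_add_distrib_mat_vec[OF V] mult_mat_vec[OF V])
  then show ?thesis using x x' unfolding colspan_iff by (metis add_carrier_vec smult_carrier_vec)
qed

definition injective_mat :: "'a :: comm_ring_1 mat \<Rightarrow> bool" where
  "injective_mat V \<longleftrightarrow> (\<forall>x \<in> carrier_vec (dim_col V). V *\<^sub>v x = 0\<^sub>v (dim_row V) \<longrightarrow> x = 0\<^sub>v (dim_col V))"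

lemma orthonormal_cols_injective:
  assumes "orthonormal_cols V"
  shows "injective_mat V"
  unfolding injective_mat_def
proof (intro ballI impI)
  fix x assume x: "x \<in> carrier_vec (dim_col V)" and Vx: "V *\<^sub>v x = 0\<^sub>v (dim_row V)"
  have V: "V \<in> carrier_mat (dim_row V) (dim_col V)" by simp
  have VH: "mat_adjoint V \<in> carrier_mat (dim_col V) (dim_row V)"
    unfolding mat_adjoint_def by (intro carrier_matI) simp_all
  have "x = (mat_adjoint V * V) *\<^sub>v x"
    using assms x unfolding orthonormal_cols_def by simp
  also have "\<dots> = mat_adjoint V *\<^sub>v 0\<^sub>v (dim_row V)"
    using assoc_mult_mat_vec[OF VH V x] Vx by simp
  also have "\<dots> = 0\<^sub>v (dim_col V)" using VH by (intro eq_vecI) auto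
  finally show "x = 0\<^sub>v (dim_col V)" .
qed

lemma mult_append_col:
  fixes V :: "'a :: comm_semiring_0 mat"
  assumes x: "x \<in> carrier_vec (Suc (dim_col V))" and v: "v \<in> carrier_vec (dim_row V)"
  shows "mat_of_cols (dim_row V) (cols V @ [v]) *\<^sub>v x
           = V *\<^sub>v vec (dim_col V) (($) x) + x $ dim_col V \<cdot>\<^sub>v v"
  (is "?M *\<^sub>v x = ?r")
proof (rule eq_vecI)
  show "dim_vec (?M *\<^sub>v x) = dim_vec ?r" using v by simp
  fix i assume "i < dim_vec ?r"
  then have i: "i < dim_row V" using v by simp
  have "(?M *\<^sub>v x) $ i = (\<Sum>j = 0..<Suc (dim_col V). ?M $$ (i, j) * x $ j)"
    using x i by (simp add: scalar_prod_def)
  also have "\<dots> = (\<Sum>j = 0..<dim_col V. V $$ (i, j) * x $ j) + x $ dim_col V * v $ i"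
    using i by (simp add: mat_of_cols_index nth_append mult.commute[of "v $ i"])
  also have "\<dots> = ?r $ i"
    using i v by (simp add: scalar_prod_def)
  finally show "(?M *\<^sub>v x) $ i = ?r $ i" .
qed

lemma colspan_append_col:
  assumes v: "v \<in> carrier_vec (dim_row V)"
  shows "colspan (mat_of_cols (dim_row V) (cols V @ [v])) = {w + b \<cdot>\<^sub>v v | w b. w \<in> colspan V}"
  (is "colspan ?M = ?S")
proof (intro equalityI subsetI)
  fix w assume "w \<in> colspan ?M"
  then obtain x where x: "x \<in> carrier_vec (Suc (dim_col V))" "w = ?M *\<^sub>v x"
    using colspan_iff[of w ?M] by auto
  then have "w = V *\<^sub>v vec (dim_col V) (($) x) + x $ dim_col V \<cdot>\<^sub>v v"
    using mult_append_col[OF _ v] by simp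
  moreover have "V *\<^sub>v vec (dim_col V) (($) x) \<in> colspan V"
    unfolding colspan_iff by (metis vec_carrier)
  ultimately show "w \<in> ?S" by blast
next
  fix w assume "w \<in> ?S"
  then obtain x b where x: "x \<in> carrier_vec (dim_col V)" and w: "w = V *\<^sub>v x + b \<cdot>\<^sub>v v"
    unfolding colspan_iff by blast
  let ?x = "vec (Suc (dim_col V)) (\<lambda>i. if i < dim_col V then x $ i else b)"
  have "vec (dim_col V) (($) ?x) = x" using x by (intro eq_vecI) auto
  then have "?M *\<^sub>v ?x = w"
    using mult_append_col[OF _ v, of ?x] w by simp
  then show "w \<in> colspan ?M" 
    using colspan_iff[of w ?M]
    by (metis (no_types, lifting) length_append_singleton cols_length mat_of_cols_carrier(3) vec_carrier)
qed

text \<open>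
  In a nontrivial expansion \<open>u = V h + \<eta> v\<close> the coefficient \<open>\<eta>\<close> cannot vanish, as \<open>u\<close> is not in the
  column space of \<open>V\<close>; so \<open>u\<close> and the new column \<open>v\<close> are interchangeable modulo the old subspace.
\<close>

lemma expands_colspan:
  assumes "expands V u V'"
  shows "colspan V' = {w + a \<cdot>\<^sub>v u | w a. w \<in> colspan V}"
proof (cases "u \<in> colspan V")
  case True
  then have "V' = V" using assms unfolding expands_def by simp
  moreover have "w + a \<cdot>\<^sub>v u \<in> colspan V" if "w \<in> colspan V" for w a
    using colspan_lincomb[OF that True, of 1 a] by simp
  moreover have "\<exists>w' a. w = w' + a \<cdot>\<^sub>v u \<and> w' \<in> colspan V" if "w \<in> colspan V" for w
    using that colspan_carrier[OF that] colspan_carrier[OF True]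
    by (intro exI[of _ w] exI[of _ 0]) (auto intro!: eq_vecI)
  ultimately show ?thesis by blast
next
  case False
  then obtain h v \<eta> where h: "h \<in> carrier_vec (dim_col V)" and v: "v \<in> carrier_vec (dim_row V)"
    and u: "u = V *\<^sub>v h + \<eta> \<cdot>\<^sub>v v" and V': "V' = mat_of_cols (dim_row V) (cols V @ [v])"
    using assms unfolding expands_def by auto
  have Vh: "V *\<^sub>v h \<in> colspan V" using h unfolding colspan_iff by blast
  have "\<eta> \<noteq> 0"
  proof
    assume "\<eta> = 0"
    then have "u = V *\<^sub>v h" using u v by (intro eq_vecI) auto
    then show False using False Vh by simp
  qed
  have "\<exists>w' b'. w + b \<cdot>\<^sub>v v = w' + b' \<cdot>\<^sub>v u \<and> w' \<in> colspan V" if w: "w \<in> colspan V" for w b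
  proof (intro exI conjI)
    show "w + b \<cdot>\<^sub>v v = (1 \<cdot>\<^sub>v w + (- (b / \<eta>)) \<cdot>\<^sub>v (V *\<^sub>v h)) + (b / \<eta>) \<cdot>\<^sub>v u"
      using v colspan_carrier[OF w] u \<open>\<eta> \<noteq> 0\<close> by (intro eq_vecI) (auto simp: field_simps)
  qed (rule colspan_lincomb[OF w Vh])
  moreover have "\<exists>w' b'. w + b \<cdot>\<^sub>v u = w' + b' \<cdot>\<^sub>v v \<and> w' \<in> colspan V" if w: "w \<in> colspan V" for w b
  proof (intro exI conjI)
    show "w + b \<cdot>\<^sub>v u = (1 \<cdot>\<^sub>v w + b \<cdot>\<^sub>v (V *\<^sub>v h)) + (b * \<eta>) \<cdot>\<^sub>v v"
      using v colspan_carrier[OF w] u by (intro eq_vecI) (auto simp: field_simps)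
  qed (rule colspan_lincomb[OF w Vh])
  ultimately show ?thesis
    unfolding V' colspan_append_col[OF v] by blast
qed

lemma expands_dim_row: "expands V u V' \<Longrightarrow> dim_row V' = dim_row V"
  unfolding expands_def by (auto split: if_splits)

text \<open>
  In a nontrivial expansion the new column lies outside the old subspace, since otherwise
  \<open>u\<close> would belong to it.
\<close>

lemma expands_injective:
  assumes exp: "expands V u V'" and inj: "injective_mat V"
  shows "injective_mat V'"
proof (cases "u \<in> colspan V")
  case True
  then show ?thesis using assms unfolding expands_def by simp
next
  case False
  then obtain h v \<eta> where h: "h \<in> carrier_vec (dim_col V)" and v: "v \<in> carrier_vec (dim_row V)"
    and u: "u = V *\<^sub>v h + \<eta> \<cdot>\<^sub>v v" and V': "V' = mat_of_cols (dim_row V) (cols V @ [v])"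
    using exp unfolding expands_def by auto
  have Vh: "V *\<^sub>v h \<in> colspan V" using h unfolding colspan_iff by blast
  have v_notin: "v \<notin> colspan V"
    using False colspan_lincomb[OF Vh, of v 1 \<eta>] u by auto
  show ?thesis unfolding injective_mat_def
  proof (intro ballI impI)
    fix x assume "x \<in> carrier_vec (dim_col V')" and "V' *\<^sub>v x = 0\<^sub>v (dim_row V')"
    then have x: "x \<in> carrier_vec (Suc (dim_col V))" and "V' *\<^sub>v x = 0\<^sub>v (dim_row V)"
      unfolding V' by auto
    moreover define t b where "t = vec (dim_col V) (($) x)" and "b = x $ dim_col V"
    ultimately have zero: "V *\<^sub>v t + b \<cdot>\<^sub>v v = 0\<^sub>v (dim_row V)"
      using mult_append_col[OF x v] unfolding V' by simp
    have t: "t \<in> carrier_vec (dim_col V)" unfolding t_def by simp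
    then have Vt: "V *\<^sub>v t \<in> colspan V" unfolding colspan_iff by blast
    have pt: "(V *\<^sub>v t) $ i + b * v $ i = 0" if "i < dim_row V" for i
      using arg_cong[OF zero, of "\<lambda>w. w $ i"] that v by simp
    have b: "b = 0"
    proof (rule ccontr)
      assume "b \<noteq> 0"
      \<comment> \<open>the zero summand gives the right-hand side the shape of a two-term combination\<close>
      have "v = (- 1 / b) \<cdot>\<^sub>v (V *\<^sub>v t) + 0 \<cdot>\<^sub>v (V *\<^sub>v t)"
      proof (rule eq_vecI)
        fix i assume "i < dim_vec ((- 1 / b) \<cdot>\<^sub>v (V *\<^sub>v t) + 0 \<cdot>\<^sub>v (V *\<^sub>v t))"
        then have i: "i < dim_row V" by simp
        have "v $ i = - (V *\<^sub>v t) $ i / b"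
          using pt[OF i] \<open>b \<noteq> 0\<close> by (simp add: field_simps add_eq_0_iff)
        then show "v $ i = ((- 1 / b) \<cdot>\<^sub>v (V *\<^sub>v t) + 0 \<cdot>\<^sub>v (V *\<^sub>v t)) $ i"
          using i by simp
      qed (use v in simp)
      then show False using v_notin colspan_lincomb[OF Vt Vt] by metis
    qed
    then have "V *\<^sub>v t = 0\<^sub>v (dim_row V)"
      using pt by (intro eq_vecI) auto
    then have "t = 0\<^sub>v (dim_col V)" using inj t unfolding injective_mat_def by blast
    then have "x $ i = 0" if "i < dim_col V" for i
      using that unfolding t_def by (metis index_vec index_zero_vec(1))
    then have "x = 0\<^sub>v (Suc (dim_col V))"
      using x b unfolding b_def by (intro eq_vecI) (auto simp: less_Suc_eq)
    then show "x = 0\<^sub>v (dim_col V')" unfolding V' by simp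
  qed
qed

lemma run_basis:
  assumes "is_run solution A sel W N V \<nu> y" and "j \<le> N"
  shows "dim_row (V j) = dim_row A" and "injective_mat (V j)"
proof -
  have "dim_row (V j) = dim_row A \<and> injective_mat (V j)"
    using \<open>j \<le> N\<close>
  proof (induction j)
    case 0
    then show ?case using assms(1) orthonormal_cols_injective unfolding is_run_def by blast
  next
    case (Suc j)
    then obtain u where "expands (V j) u (V (Suc j))"
      using assms(1) unfolding is_run_def by (meson Suc_le_lessD)
    then show ?case using Suc expands_dim_row expands_injective by (metis Suc_leD)
  qed
  then show "dim_row (V j) = dim_row A" and "injective_mat (V j)" by auto
qed

lemma extracted_vector:
  assumes "extracts A sel V \<nu> y" and "injective_mat V"
  shows "y \<in> colspan V" and "y \<noteq> 0\<^sub>v (dim_row V)"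
proof -
  obtain z where "eigenvector (mat_adjoint V * A * V) z \<nu>" and y: "y = V *\<^sub>v z"
    using assms(1) unfolding extracts_def by blast
  moreover have "dim_row (mat_adjoint V * A * V) = dim_col V"
    unfolding mat_adjoint_def by simp
  ultimately have z: "z \<in> carrier_vec (dim_col V)" "z \<noteq> 0\<^sub>v (dim_col V)"
    unfolding eigenvector_def by auto
  then show "y \<in> colspan V" unfolding colspan_iff y by blast
  show "y \<noteq> 0\<^sub>v (dim_row V)" using assms(2) z unfolding injective_mat_def y by blast
qed

section \<open>The two inner equations\<close>

lemma compl_proj_mult:
  assumes "y \<in> carrier_vec n" and "w \<in> carrier_vec n"
  shows "compl_proj y *\<^sub>v w = w - (w \<bullet>c y) \<cdot>\<^sub>v y"
proof -
  have rank_one: "mat n n (\<lambda>(i, j). y $ i * cnj (y $ j)) *\<^sub>v w = (w \<bullet>c y) \<cdot>\<^sub>v y"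
    using assms
    by (intro eq_vecI) (auto simp: scalar_prod_def sum_distrib_left sum_distrib_right ac_simps)
  have "compl_proj y *\<^sub>v w = 1\<^sub>m n *\<^sub>v w - mat n n (\<lambda>(i, j). y $ i * cnj (y $ j)) *\<^sub>v w"
    using assms unfolding compl_proj_def
    by (simp add: minus_mult_distrib_mat_vec[of _ n n])
  then show ?thesis
    using rank_one assms by simp
qed

lemma shifted_carrier: "A \<in> carrier_mat n n \<Longrightarrow> shifted A \<sigma> \<in> carrier_mat n n"
  unfolding shifted_def by auto

lemma shifted_mult:
  assumes "A \<in> carrier_mat n n" and "w \<in> carrier_vec n"
  shows "shifted A \<sigma> *\<^sub>v w = A *\<^sub>v w - \<sigma> \<cdot>\<^sub>v w"
proof -
  have "(\<sigma> \<cdot>\<^sub>m 1\<^sub>m n) *\<^sub>v w = \<sigma> \<cdot>\<^sub>v w" using assms by (intro eq_vecI) auto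
  then show ?thesis using assms unfolding shifted_def
    by (simp add: minus_mult_distrib_mat_vec[of _ n n])
qed

lemma residual_shifted:
  assumes "A \<in> carrier_mat n n" and "y \<in> carrier_vec n"
  shows "residual A \<nu> y = shifted A \<sigma> *\<^sub>v y + (\<sigma> - \<nu>) \<cdot>\<^sub>v y"
  unfolding residual_def shifted_mult[OF assms]
  using assms by (intro eq_vecI) (auto simp: algebra_simps)

lemma shifted_injective:
  assumes A: "A \<in> carrier_mat n n" and "\<not> eigenvalue A \<sigma>"
    and w: "w \<in> carrier_vec n" and "shifted A \<sigma> *\<^sub>v w = 0\<^sub>v n"
  shows "w = 0\<^sub>v n"
proof (rule ccontr)
  assume "w \<noteq> 0\<^sub>v n"
  moreover have diff: "A *\<^sub>v w - \<sigma> \<cdot>\<^sub>v w = 0\<^sub>v n" using assms shifted_mult by metis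
  have "A *\<^sub>v w = \<sigma> \<cdot>\<^sub>v w"
  proof (rule eq_vecI)
    fix i assume "i < dim_vec (\<sigma> \<cdot>\<^sub>v w)"
    then show "(A *\<^sub>v w) $ i = (\<sigma> \<cdot>\<^sub>v w) $ i"
      using arg_cong[OF diff, of "\<lambda>w. w $ i"] w A by simp
  qed (use A w in simp)
  ultimately show False
    using assms unfolding eigenvalue_def eigenvector_def by auto
qed

lemma sira_solution_shifted:
  assumes A: "A \<in> carrier_mat n n" and y: "y \<in> carrier_vec n"
    and sol: "sira_solution A \<sigma> \<nu> y u"
  shows "shifted A \<sigma> *\<^sub>v (u - y) = (\<sigma> - \<nu>) \<cdot>\<^sub>v y"
proof -
  note B = shifted_carrier[OF A, of \<sigma>]
  have u: "u \<in> carrier_vec n" and eq: "shifted A \<sigma> *\<^sub>v u = residual A \<nu> y"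
    using sol A unfolding sira_solution_def by auto
  show ?thesis
    unfolding mult_minus_distrib_mat_vec[OF B u y] eq residual_shifted[OF A y, of \<nu> \<sigma>]
    using B y by (intro eq_vecI) auto
qed

lemma jd_solution_shifted:
  assumes A: "A \<in> carrier_mat n n" and y: "y \<in> carrier_vec n"
    and sol: "jd_solution A \<sigma> \<nu> y u"
  shows "\<exists>\<beta>. shifted A \<sigma> *\<^sub>v (u + y) = \<beta> \<cdot>\<^sub>v y"
proof -
  note B = shifted_carrier[OF A, of \<sigma>]
  have P: "compl_proj y \<in> carrier_mat n n" using y unfolding compl_proj_def by auto
  have u: "u \<in> carrier_vec n" and orth: "u \<bullet>c y = 0"
    and eq: "(compl_proj y * shifted A \<sigma> * compl_proj y) *\<^sub>v u = - residual A \<nu> y"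
    using sol A unfolding jd_solution_def by auto
  have Bu: "shifted A \<sigma> *\<^sub>v u \<in> carrier_vec n" using B u by simp
  define \<alpha> where "\<alpha> = (shifted A \<sigma> *\<^sub>v u) \<bullet>c y"
  have Pu: "compl_proj y *\<^sub>v u = u"
    unfolding compl_proj_mult[OF y u] orth using u y by (intro eq_vecI) auto
  have "(compl_proj y * shifted A \<sigma> * compl_proj y) *\<^sub>v u
      = compl_proj y *\<^sub>v (shifted A \<sigma> *\<^sub>v (compl_proj y *\<^sub>v u))"
    using P B u by (simp add: assoc_mult_mat_vec[of _ n n _ n])
  also have "\<dots> = shifted A \<sigma> *\<^sub>v u - \<alpha> \<cdot>\<^sub>v y"
    unfolding Pu compl_proj_mult[OF y Bu] \<alpha>_def ..
  finally have key: "shifted A \<sigma> *\<^sub>v u - \<alpha> \<cdot>\<^sub>v y = - (shifted A \<sigma> *\<^sub>v y + (\<sigma> - \<nu>) \<cdot>\<^sub>v y)"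
    using eq residual_shifted[OF A y] by simp
  have "shifted A \<sigma> *\<^sub>v (u + y) = (\<alpha> - (\<sigma> - \<nu>)) \<cdot>\<^sub>v y"
    unfolding mult_add_distrib_mat_vec[OF B u y]
  proof (rule eq_vecI)
    fix i assume "i < dim_vec ((\<alpha> - (\<sigma> - \<nu>)) \<cdot>\<^sub>v y)"
    then have i: "i < n" using y by simp
    have "(shifted A \<sigma> *\<^sub>v u) $ i - \<alpha> * y $ i
        = - ((shifted A \<sigma> *\<^sub>v y) $ i + (\<sigma> - \<nu>) * y $ i)"
      using arg_cong[OF key, of "\<lambda>w. w $ i"] i B y
      by (simp del: index_mult_mat_vec)
    then show "(shifted A \<sigma> *\<^sub>v u + shifted A \<sigma> *\<^sub>v y) $ i = ((\<alpha> - (\<sigma> - \<nu>)) \<cdot>\<^sub>v y) $ i"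
      using i B y by (simp add: algebra_simps del: index_mult_mat_vec)
  qed (use B y in simp)
  then show ?thesis ..
qed

text \<open>
  Both \<open>u\<^sub>S - y\<close> and \<open>u\<^sub>J + c y\<close> are preimages of multiples of \<open>y\<close> under the injective matrix
  \<open>A - \<sigma>I\<close>. The scalar \<open>c\<close> accounts for JD working with another representative of the approximate
  eigenvector than SIRA does.
\<close>

lemma sira_jd_solutions_proportional:
  assumes A: "A \<in> carrier_mat n n" and ev: "\<not> eigenvalue A \<sigma>" and "\<sigma> \<noteq> \<nu>"
    and y: "y \<in> carrier_vec n" and "y \<noteq> 0\<^sub>v n" and "c \<noteq> 0"
    and sira: "sira_solution A \<sigma> \<nu> y u\<^sub>S" and jd: "jd_solution A \<sigma> \<nu> (c \<cdot>\<^sub>v y) u\<^sub>J"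
  shows "\<exists>k. k \<noteq> 0 \<and> u\<^sub>J + c \<cdot>\<^sub>v y = k \<cdot>\<^sub>v (u\<^sub>S - y)"
proof -
  note B = shifted_carrier[OF A, of \<sigma>]
  have cy: "c \<cdot>\<^sub>v y \<in> carrier_vec n" using y by simp
  have uS: "u\<^sub>S \<in> carrier_vec n" and uJ: "u\<^sub>J \<in> carrier_vec n" and orth: "u\<^sub>J \<bullet>c (c \<cdot>\<^sub>v y) = 0"
    using sira jd A unfolding sira_solution_def jd_solution_def by auto
  obtain \<beta> where \<beta>: "shifted A \<sigma> *\<^sub>v (u\<^sub>J + c \<cdot>\<^sub>v y) = \<beta> \<cdot>\<^sub>v (c \<cdot>\<^sub>v y)"
    using jd_solution_shifted[OF A cy jd] by blast
  define k where "k = \<beta> * c / (\<sigma> - \<nu>)"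
  have wS: "u\<^sub>S - y \<in> carrier_vec n" and wJ: "u\<^sub>J + c \<cdot>\<^sub>v y \<in> carrier_vec n"
    using uS uJ y by auto
  have "shifted A \<sigma> *\<^sub>v (u\<^sub>J + c \<cdot>\<^sub>v y - k \<cdot>\<^sub>v (u\<^sub>S - y))
      = \<beta> \<cdot>\<^sub>v (c \<cdot>\<^sub>v y) - k \<cdot>\<^sub>v ((\<sigma> - \<nu>) \<cdot>\<^sub>v y)"
    using wS wJ mult_minus_distrib_mat_vec[OF B wJ smult_carrier_vec[THEN iffD2, OF wS]]
      mult_mat_vec[OF B wS] \<beta> sira_solution_shifted[OF A y sira] by simp
  also have "\<dots> = 0\<^sub>v n"
    using y \<open>\<sigma> \<noteq> \<nu>\<close> unfolding k_def by (intro eq_vecI) auto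
  finally have image: "shifted A \<sigma> *\<^sub>v (u\<^sub>J + c \<cdot>\<^sub>v y - k \<cdot>\<^sub>v (u\<^sub>S - y)) = 0\<^sub>v n" .
  have zero: "u\<^sub>J + c \<cdot>\<^sub>v y - k \<cdot>\<^sub>v (u\<^sub>S - y) = 0\<^sub>v n"
    by (rule shifted_injective[OF A ev _ image]) (use wS wJ in simp)
  have eq: "u\<^sub>J + c \<cdot>\<^sub>v y = k \<cdot>\<^sub>v (u\<^sub>S - y)"
  proof (rule eq_vecI)
    fix i assume "i < dim_vec (k \<cdot>\<^sub>v (u\<^sub>S - y))"
    then show "(u\<^sub>J + c \<cdot>\<^sub>v y) $ i = (k \<cdot>\<^sub>v (u\<^sub>S - y)) $ i"
      using arg_cong[OF zero, of "\<lambda>w. w $ i"] uS uJ y by simp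
  qed (use uS uJ y in simp)
  moreover have "k \<noteq> 0"
  proof
    assume "k = 0"
    then have "u\<^sub>J + c \<cdot>\<^sub>v y = 0\<^sub>v n" using eq uS y by (intro eq_vecI) auto
    then have "(u\<^sub>J + c \<cdot>\<^sub>v y) \<bullet>c (c \<cdot>\<^sub>v y) = 0" using cy by simp
    moreover have "(u\<^sub>J + c \<cdot>\<^sub>v y) \<bullet>c (c \<cdot>\<^sub>v y) = u\<^sub>J \<bullet>c (c \<cdot>\<^sub>v y) + (c \<cdot>\<^sub>v y) \<bullet>c (c \<cdot>\<^sub>v y)"
      using uJ cy by (intro add_scalar_prod_distrib[of _ n]) auto
    ultimately have cy0: "c \<cdot>\<^sub>v y = 0\<^sub>v n"
      using orth conjugate_square_eq_0_vec[OF cy] by simp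
    have "y = 0\<^sub>v n"
    proof (rule eq_vecI)
      fix i assume "i < dim_vec (0\<^sub>v n :: complex vec)"
      then show "y $ i = 0\<^sub>v n $ i"
        using arg_cong[OF cy0, of "\<lambda>w. w $ i"] y \<open>c \<noteq> 0\<close> by simp
    qed (use y in simp)
    then show False using \<open>y \<noteq> 0\<^sub>v n\<close> by simp
  qed
  ultimately show ?thesis by blast
qed

section \<open>Equivalence of the two methods\<close>

lemma extracted_pair_unique:
  assumes "extracts A sel V \<nu> y" and "extracts A sel V' \<nu>' y'" and "colspan V = colspan V'"
  shows "\<nu> = \<nu>'" and "\<exists>c. cmod c = 1 \<and> y' = c \<cdot>\<^sub>v y"
proof -
  show "\<nu> = \<nu>'" using assms unfolding extracts_def by simp
  obtain a b where a: "cmod a = 1" "y = a \<cdot>\<^sub>v snd (sel (colspan V))"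
    and b: "cmod b = 1" "y' = b \<cdot>\<^sub>v snd (sel (colspan V))"
    using assms unfolding extracts_def by auto
  have "a \<noteq> 0" using a(1) by auto
  then have "y' = (b / a) \<cdot>\<^sub>v y" using a b by (simp add: smult_smult_assoc)
  moreover have "cmod (b / a) = 1" using a b by (simp add: norm_divide)
  ultimately show "\<exists>c. cmod c = 1 \<and> y' = c \<cdot>\<^sub>v y" by blast
qed

lemma expansion_subset:
  assumes "w \<in> colspan V" and u: "u \<in> carrier_vec (dim_row V)" and u': "u' = k \<cdot>\<^sub>v u + w"
  shows "{w + a \<cdot>\<^sub>v u' | w a. w \<in> colspan V} \<subseteq> {w + a \<cdot>\<^sub>v u | w a. w \<in> colspan V}"
proof clarify
  fix x a assume x: "x \<in> colspan V"
  have "x + a \<cdot>\<^sub>v u' = (1 \<cdot>\<^sub>v x + a \<cdot>\<^sub>v w) + (a * k) \<cdot>\<^sub>v u"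
    using u u' colspan_carrier[OF x] colspan_carrier[OF assms(1)]
    by (intro eq_vecI) (auto simp: algebra_simps)
  then show "\<exists>y b. x + a \<cdot>\<^sub>v u' = y + b \<cdot>\<^sub>v u \<and> y \<in> colspan V"
    using colspan_lincomb[OF x assms(1)] by blast
qed

lemma sira_jd_expansions_equal:
  assumes A: "A \<in> carrier_mat n n" and ev: "\<not> eigenvalue A \<sigma>" and "\<sigma> \<noteq> \<nu>"
    and dim: "dim_row V = n" and y: "y \<in> colspan V" "y \<noteq> 0\<^sub>v n" and "c \<noteq> 0"
    and sira: "sira_solution A \<sigma> \<nu> y u\<^sub>S" and jd: "jd_solution A \<sigma> \<nu> (c \<cdot>\<^sub>v y) u\<^sub>J"
  shows "{w + a \<cdot>\<^sub>v u\<^sub>S | w a. w \<in> colspan V} = {w + a \<cdot>\<^sub>v u\<^sub>J | w a. w \<in> colspan V}"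
proof (rule equalityI)
  have yn: "y \<in> carrier_vec n" using colspan_carrier[OF y(1)] dim by simp
  have uS: "u\<^sub>S \<in> carrier_vec n" and uJ: "u\<^sub>J \<in> carrier_vec n"
    using sira jd A unfolding sira_solution_def jd_solution_def by auto
  obtain k where "k \<noteq> 0" and eq: "u\<^sub>J + c \<cdot>\<^sub>v y = k \<cdot>\<^sub>v (u\<^sub>S - y)"
    using sira_jd_solutions_proportional[OF A ev \<open>\<sigma> \<noteq> \<nu>\<close> yn y(2) \<open>c \<noteq> 0\<close> sira jd] by blast
  have pt: "u\<^sub>J $ i + c * y $ i = k * (u\<^sub>S $ i - y $ i)" if "i < n" for i
    using arg_cong[OF eq, of "\<lambda>w. w $ i"] that yn uS uJ by simp
  have J: "u\<^sub>J = k \<cdot>\<^sub>v u\<^sub>S + ((- k) \<cdot>\<^sub>v y + (- c) \<cdot>\<^sub>v y)"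
  proof (rule eq_vecI)
    fix i assume "i < dim_vec (k \<cdot>\<^sub>v u\<^sub>S + ((- k) \<cdot>\<^sub>v y + (- c) \<cdot>\<^sub>v y))"
    then have i: "i < n" using yn by simp
    have "u\<^sub>J $ i = k * u\<^sub>S $ i + (- k * y $ i + - c * y $ i)"
      using pt[OF i] by (simp add: algebra_simps)
    then show "u\<^sub>J $ i = (k \<cdot>\<^sub>v u\<^sub>S + ((- k) \<cdot>\<^sub>v y + (- c) \<cdot>\<^sub>v y)) $ i"
      using i yn uS by simp
  qed (use yn uJ in simp)
  have S: "u\<^sub>S = (1 / k) \<cdot>\<^sub>v u\<^sub>J + (1 \<cdot>\<^sub>v y + (c / k) \<cdot>\<^sub>v y)"
  proof (rule eq_vecI)
    fix i assume "i < dim_vec ((1 / k) \<cdot>\<^sub>v u\<^sub>J + (1 \<cdot>\<^sub>v y + (c / k) \<cdot>\<^sub>v y))"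
    then have i: "i < n" using yn by simp
    have "u\<^sub>S $ i = 1 / k * u\<^sub>J $ i + (1 * y $ i + c / k * y $ i)"
      using pt[OF i] \<open>k \<noteq> 0\<close> by (simp add: field_simps)
    then show "u\<^sub>S $ i = ((1 / k) \<cdot>\<^sub>v u\<^sub>J + (1 \<cdot>\<^sub>v y + (c / k) \<cdot>\<^sub>v y)) $ i"
      using i yn uJ by simp
  qed (use yn uS in simp)
  show "{w + a \<cdot>\<^sub>v u\<^sub>J | w a. w \<in> colspan V} \<subseteq> {w + a \<cdot>\<^sub>v u\<^sub>S | w a. w \<in> colspan V}"
    by (rule expansion_subset[OF colspan_lincomb[OF y(1) y(1)] _ J]) (simp add: dim uS)
  show "{w + a \<cdot>\<^sub>v u\<^sub>S | w a. w \<in> colspan V} \<subseteq> {w + a \<cdot>\<^sub>v u\<^sub>J | w a. w \<in> colspan V}"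
    by (rule expansion_subset[OF colspan_lincomb[OF y(1) y(1)] _ S]) (simp add: dim uJ)
qed

theorem theorem1:
  fixes A :: "complex mat" and \<sigma> :: complex and n N :: nat
    and sel :: selection and W :: "complex vec set"
    and V\<^sub>S V\<^sub>J :: "nat \<Rightarrow> complex mat"
    and \<nu>\<^sub>S \<nu>\<^sub>J :: "nat \<Rightarrow> complex"
    and y\<^sub>S y\<^sub>J :: "nat \<Rightarrow> complex vec"
  assumes "A \<in> carrier_mat n n"
    and "\<not> eigenvalue A \<sigma>"
    and "sira_run A \<sigma> sel W N V\<^sub>S \<nu>\<^sub>S y\<^sub>S"
    and "jd_run A \<sigma> sel W N V\<^sub>J \<nu>\<^sub>J y\<^sub>J"
    and "\<And>j. j < N \<Longrightarrow> \<sigma> \<noteq> \<nu>\<^sub>S j"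
  shows "\<forall>j\<le>N. colspan (V\<^sub>S j) = colspan (V\<^sub>J j) \<and> \<nu>\<^sub>S j = \<nu>\<^sub>J j \<and>
           (\<exists>c. cmod c = 1 \<and> y\<^sub>J j = c \<cdot>\<^sub>v y\<^sub>S j)"
proof -
  note S = assms(3)[unfolded sira_run_def] and J = assms(4)[unfolded jd_run_def]
  have exS: "extracts A sel (V\<^sub>S j) (\<nu>\<^sub>S j) (y\<^sub>S j)" if "j \<le> N" for j
    using S that unfolding is_run_def by blast
  have exJ: "extracts A sel (V\<^sub>J j) (\<nu>\<^sub>J j) (y\<^sub>J j)" if "j \<le> N" for j
    using J that unfolding is_run_def by blast
  have same: "colspan (V\<^sub>S j) = colspan (V\<^sub>J j)" if "j \<le> N" for j
    using that
  proof (induction j)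
    case 0
    then show ?case using S J unfolding is_run_def by blast
  next
    case (Suc j)
    then have j: "j < N" "j \<le> N" and IH: "colspan (V\<^sub>S j) = colspan (V\<^sub>J j)" by auto
    obtain u\<^sub>S where uS: "sira_solution A \<sigma> (\<nu>\<^sub>S j) (y\<^sub>S j) u\<^sub>S" "expands (V\<^sub>S j) u\<^sub>S (V\<^sub>S (Suc j))"
      using S j unfolding is_run_def by blast
    obtain u\<^sub>J where uJ: "jd_solution A \<sigma> (\<nu>\<^sub>J j) (y\<^sub>J j) u\<^sub>J" "expands (V\<^sub>J j) u\<^sub>J (V\<^sub>J (Suc j))"
      using J j unfolding is_run_def by blast
    have \<nu>: "\<nu>\<^sub>S j = \<nu>\<^sub>J j" using extracted_pair_unique(1)[OF exS[OF j(2)] exJ[OF j(2)] IH] .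
    obtain c where c: "cmod c = 1" "y\<^sub>J j = c \<cdot>\<^sub>v y\<^sub>S j"
      using extracted_pair_unique(2)[OF exS[OF j(2)] exJ[OF j(2)] IH] by blast
    have dim: "dim_row (V\<^sub>S j) = n" using run_basis(1)[OF S j(2)] assms(1) by simp
    note y = extracted_vector[OF exS[OF j(2)] run_basis(2)[OF S j(2)], unfolded dim]
    have "{w + a \<cdot>\<^sub>v u\<^sub>S | w a. w \<in> colspan (V\<^sub>S j)} = {w + a \<cdot>\<^sub>v u\<^sub>J | w a. w \<in> colspan (V\<^sub>S j)}"
    proof (rule sira_jd_expansions_equal[OF assms(1,2) assms(5)[OF j(1)] dim])
      show "y\<^sub>S j \<in> colspan (V\<^sub>S j)" using y(1) dim by simp
      show "y\<^sub>S j \<noteq> 0\<^sub>v n" by (rule y(2))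
      show "c \<noteq> 0" using c(1) by auto
      show "sira_solution A \<sigma> (\<nu>\<^sub>S j) (y\<^sub>S j) u\<^sub>S" by (rule uS(1))
      show "jd_solution A \<sigma> (\<nu>\<^sub>S j) (c \<cdot>\<^sub>v y\<^sub>S j) u\<^sub>J" using uJ(1) \<nu> c(2) by simp
    qed
    then show ?case
      unfolding expands_colspan[OF uS(2)] expands_colspan[OF uJ(2)] IH .
  qed
  show ?thesis
    using same extracted_pair_unique[OF exS exJ same] by blast
qed

end
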